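(* Let $LB\ge 0$ be a lower bound on the optimal objective function value of (PC2). Then the linear program (PCLB) $$\begin{aligned}\mathcal L(LB)=\min\ & z\\ \text{s.t. } & \sum_{j\in J}y_j=p\\ & z\ge d_{ij}-\sum_{j'\in J:\,d_{ij'}<d_{ij}}\big(d_{ij}-\max\{LB,d_{ij'}\}\big)y_{j'} && \forall i\in I,\ \forall j\in J:\ d_{ij}>LB\\ & z\ge LB\\ & 0\le y_j\le 1 && \forall j\in J\\ & z\in\mathbb R\end{aligned}$$ is an LP-relaxation of (PC2). In particular, $\mathcal L(LB)$ is a lower bound on the optimal objective function value of (PC2), and $\mathcal L(LB)\ge LB$.
   Context: An instance of the $p$-center problem consists of a finite nonempty set $I$ of customer demand points, a finite nonempty set $J$ of potential facility locations, an integer $p$ with $1\le p\le |J|$, and real distances $d_{ij}\ge 0$ for $i\in I$, $j\in J$. (PC2) is the mixed-integer program: minimize $z$ subject to $\sum_{j\in J}y_j=p$; $z\ge d_{ij}-\sum_{j'\in J:\,d_{ij'}<d_{ij}}(d_{ij}-d_{ij'})y_{j'}$ for all $i\in I$, $j\in J$; $y_j\in\{0,1\}$ for all $j\in J$; $z\in\mathbb R$. A linear program in the variables $(y,z)$ with objective $\min z$ is called an LP-relaxation of (PC2) if every feasible solution $(y,z)$ of (PC2) is feasible for it. *)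

theory Defs
  imports Complex_Main "HOL-Library.Extended_Real"
begin

text \<open>
  Throughout, a point is a pair \<open>(y, z)\<close> with \<open>y :: 'j \<Rightarrow> real\<close>. Only the coordinates
  \<open>y j\<close> with \<open>j \<in> J\<close> are variables of the programs; the values of \<open>y\<close> outside \<open>J\<close>
  are unconstrained and irrelevant.
\<close>

definition PC2_feasible ::
  "'i set \<Rightarrow> 'j set \<Rightarrow> nat \<Rightarrow> ('i \<Rightarrow> 'j \<Rightarrow> real) \<Rightarrow> (('j \<Rightarrow> real) \<times> real) set" where
  "PC2_feasible I J p d = {(y, z).
     (\<Sum>j\<in>J. y j) = real p \<and>
     (\<forall>i\<in>I. \<forall>j\<in>J. z \<ge> d i j - (\<Sum>j'\<in>{j'\<in>J. d i j' < d i j}. (d i j - d i j') * y j')) \<and>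
     (\<forall>j\<in>J. y j \<in> {0, 1})}"

definition PCLB_feasible ::
  "'i set \<Rightarrow> 'j set \<Rightarrow> nat \<Rightarrow> ('i \<Rightarrow> 'j \<Rightarrow> real) \<Rightarrow> real \<Rightarrow> (('j \<Rightarrow> real) \<times> real) set" where
  "PCLB_feasible I J p d LB = {(y, z).
     (\<Sum>j\<in>J. y j) = real p \<and>
     (\<forall>i\<in>I. \<forall>j\<in>J. d i j > LB \<longrightarrow>
        z \<ge> d i j - (\<Sum>j'\<in>{j'\<in>J. d i j' < d i j}. (d i j - max LB (d i j')) * y j')) \<and>
     z \<ge> LB \<and>
     (\<forall>j\<in>J. 0 \<le> y j \<and> y j \<le> 1)}"

text \<open>
  The optimal value of ``minimize \<open>z\<close> over \<open>F\<close>''. It is taken in the extended reals, so that it is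
  \<open>\<infinity>\<close> for an infeasible and \<open>-\<infinity>\<close> for an unbounded program.
\<close>

definition opt_value :: "(('j \<Rightarrow> real) \<times> real) set \<Rightarrow> ereal" where
  "opt_value F = (INF (y, z)\<in>F. ereal z)"

text \<open>
  \<open>F\<close> is the feasible set of a linear program in \<open>(y, z)\<close>: a triple \<open>(a, c, b)\<close> encodes the
  inequality \<open>(\<Sum>j\<in>J. a j * y j) + c * z \<ge> b\<close>; an equation is a pair of opposite inequalities.
\<close>

definition linear_program :: "'j set \<Rightarrow> (('j \<Rightarrow> real) \<times> real) set \<Rightarrow> bool" where
  "linear_program J F \<longleftrightarrow>
     (\<exists>C :: (('j \<Rightarrow> real) \<times> real \<times> real) set. finite C \<and>
        F = {(y, z). \<forall>(a, c, b)\<in>C. (\<Sum>j\<in>J. a j * y j) + c * z \<ge> b})"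

definition LP_relaxation_PC2 ::
  "'i set \<Rightarrow> 'j set \<Rightarrow> nat \<Rightarrow> ('i \<Rightarrow> 'j \<Rightarrow> real) \<Rightarrow> (('j \<Rightarrow> real) \<times> real) set \<Rightarrow> bool" where
  "LP_relaxation_PC2 I J p d F \<longleftrightarrow> linear_program J F \<and> PC2_feasible I J p d \<subseteq> F"

end

theory Submission
  imports Defs "HOL-Analysis.Function_Topology"
begin

text \<open>
  Two points carry the theorem.

  \<^emph>\<open>Relaxation.\<close> Let \<open>(y, z)\<close> be feasible for (PC2); then \<open>z \<ge> LB\<close>, because \<open>LB\<close> is a lower
  bound on the optimal value. Replacing \<open>d i j'\<close> by \<open>max LB (d i j')\<close> changes the constraint of
  a pair \<open>(i, j)\<close> only through open facilities \<open>j'\<close> with \<open>d i j' < LB\<close>. If there is such a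
  facility, its term alone pushes the right-hand side down to at most \<open>LB\<close>, and \<open>z \<ge> LB\<close> suffices;
  otherwise the strengthened constraint coincides with the original one
  (\<open>PC2_feasible_subset_PCLB_feasible\<close>). The argument uses that \<open>y\<close> is binary.

  \<^emph>\<open>Attainment.\<close> The minimum in the definition of \<open>\<L>(LB)\<close> exists by compactness. A linear
  program has a closed feasible set, and it does not look at coordinates of \<open>y\<close> outside \<open>J\<close>, so these
  may be set to \<open>0\<close>. If in addition the \<open>y\<close>-coordinates in \<open>J\<close> lie in \<open>[0, 1]\<close> and \<open>z\<close> is bounded
  below, then by Tychonoff the points that are at least as good as a given one form a compact set,
  on which \<open>z\<close> attains its minimum (\<open>linear_program_attains_opt_value\<close>).

  The inequalities between the optimal values are then monotonicity of the infimum, together with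
  the constraint \<open>z \<ge> LB\<close>.
\<close>

section \<open>Linear programs\<close>

lemma linear_program_halfspace:
  "linear_program J {(y, z). (\<Sum>j\<in>J. a j * y j) + c * z \<ge> b}"
  unfolding linear_program_def by (rule exI[of _ "{(a, c, b)}"]) auto

lemma linear_program_INT:
  assumes "finite T" and "\<And>t. t \<in> T \<Longrightarrow> linear_program J (G t)"
  shows "linear_program J (\<Inter>t\<in>T. G t)"
proof -
  have "\<forall>t\<in>T. \<exists>C. finite C \<and>
      G t = {(y, z). \<forall>(a, c, b)\<in>C. (\<Sum>j\<in>J. a j * y j) + c * z \<ge> b}"
    using assms(2) by (simp add: linear_program_def)
  from bchoice[OF this] obtain C where C: "\<forall>t\<in>T. finite (C t) \<and>
      G t = {(y, z). \<forall>(a, c, b)\<in>C t. (\<Sum>j\<in>J. a j * y j) + c * z \<ge> b}" ..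
  show ?thesis
    unfolding linear_program_def
  proof (intro exI conjI)
    show "finite (\<Union>t\<in>T. C t)" using assms(1) C by simp
    show "(\<Inter>t\<in>T. G t) =
        {(y, z). \<forall>(a, c, b)\<in>(\<Union>t\<in>T. C t). (\<Sum>j\<in>J. a j * y j) + c * z \<ge> b}"
      using C by auto
  qed
qed

lemma linear_program_Int:
  assumes "linear_program J F" and "linear_program J G"
  shows "linear_program J (F \<inter> G)"
  using linear_program_INT[of "{True, False}" J "\<lambda>t. if t then F else G"] assms
  by (simp add: Int_commute)

lemma linear_program_cong_on:
  assumes "linear_program J F" and "(y, z) \<in> F" and "\<And>j. j \<in> J \<Longrightarrow> y' j = y j"
  shows "(y', z) \<in> F"
proof -
  have "(\<Sum>j\<in>J. a j * y' j) = (\<Sum>j\<in>J. a j * y j)" for a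
    using assms(3) by (intro sum.cong) auto
  then show ?thesis using assms(1,2) unfolding linear_program_def by auto
qed

lemma closed_linear_program:
  fixes F :: "(('j \<Rightarrow> real) \<times> real) set"
  assumes "linear_program J F"
  shows "closed F"
proof -
  obtain C where F: "F = {(y, z). \<forall>(a, c, b)\<in>C. (\<Sum>j\<in>J. a j * y j) + c * z \<ge> b}"
    using assms unfolding linear_program_def by blast
  have coord: "continuous_on UNIV (\<lambda>x :: ('j \<Rightarrow> real) \<times> real. fst x j)" for j
    using continuous_on_product_then_coordinatewise[OF continuous_on_fst[OF continuous_on_id]] .
  have "closed {x :: ('j \<Rightarrow> real) \<times> real. b \<le> (\<Sum>j\<in>J. a j * fst x j) + c * snd x}" for a b c
    by (intro closed_Collect_le continuous_intros coord)
  moreover have "F = (\<Inter>(a, c, b)\<in>C. {x. b \<le> (\<Sum>j\<in>J. a j * fst x j) + c * snd x})"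
    unfolding F by auto
  ultimately show ?thesis by (simp add: closed_INT case_prod_unfold)
qed

lemma opt_value_mono: "F \<subseteq> G \<Longrightarrow> opt_value G \<le> opt_value F"
  unfolding opt_value_def by (rule INF_superset_mono) auto

lemma opt_value_greatest:
  "(\<And>y z. (y, z) \<in> F \<Longrightarrow> l \<le> ereal z) \<Longrightarrow> l \<le> opt_value F"
  unfolding opt_value_def by (auto intro: INF_greatest)

lemma opt_value_lower: "(y, z) \<in> F \<Longrightarrow> opt_value F \<le> ereal z"
  unfolding opt_value_def by (rule INF_lower2[of "(y, z)"]) auto

text \<open>
  The coordinates outside \<open>J\<close> are free, so the feasible set itself is compact only up to
  normalising them; the proof minimises over the points with value \<open>0\<close> there.
\<close>

lemma linear_program_attains_opt_value:
  fixes F :: "(('j \<Rightarrow> real) \<times> real) set"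
  assumes lp: "linear_program J F" and "F \<noteq> {}"
    and box: "\<And>y z j. (y, z) \<in> F \<Longrightarrow> j \<in> J \<Longrightarrow> y j \<in> {0..1}"
    and lower: "\<And>y z. (y, z) \<in> F \<Longrightarrow> l \<le> z"
  shows "\<exists>(y, z)\<in>F. ereal z = opt_value F"
proof -
  define normal where "normal y j = (if j \<in> J then y j else 0)" for y :: "'j \<Rightarrow> real" and j
  define B :: "('j \<Rightarrow> real) set" where "B = (\<Pi>\<^sub>E j\<in>UNIV. if j \<in> J then {0..1} else {0})"
  have normal_F: "(normal y, z) \<in> F" if "(y, z) \<in> F" for y z
    using linear_program_cong_on[OF lp that] by (simp add: normal_def)
  have normal_B: "normal y \<in> B" if "(y, z) \<in> F" for y z
    using box[OF that] by (auto simp: normal_def B_def PiE_UNIV_domain)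
  obtain y0 z0 where start: "(y0, z0) \<in> F" using \<open>F \<noteq> {}\<close> by auto
  define K where "K = (B \<times> {l..z0}) \<inter> F"
  have "compact B"
  proof -
    have "compactin (product_topology (\<lambda>j :: 'j. euclidean :: real topology) UNIV) B"
      unfolding B_def compactin_PiE by auto
    then show ?thesis by (simp add: euclidean_product_topology)
  qed
  then have "compact K"
    unfolding K_def by (intro compact_Int_closed compact_Times closed_linear_program[OF lp]) auto
  moreover have "(normal y0, z0) \<in> K"
    unfolding K_def using start normal_F normal_B lower by auto
  moreover have "continuous_on K snd" by (intro continuous_intros)
  ultimately obtain x where "x \<in> K" and min: "\<And>x'. x' \<in> K \<Longrightarrow> snd x \<le> snd x'"
    using continuous_attains_inf[of K snd] by blast
  obtain y z where x: "x = (y, z)" by fastforce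
  have "(y, z) \<in> F" and "z \<le> z0" using \<open>x \<in> K\<close> unfolding K_def x by auto
  have "z \<le> z'" if "(y', z') \<in> F" for y' z'
  proof (cases "z' \<le> z0")
    case True
    then have "(normal y', z') \<in> K"
      unfolding K_def using that normal_F normal_B lower by auto
    then show ?thesis using min x by fastforce
  next
    case False
    then show ?thesis using \<open>z \<le> z0\<close> by simp
  qed
  then have "ereal z \<le> opt_value F" by (auto intro: opt_value_greatest)
  with opt_value_lower[OF \<open>(y, z) \<in> F\<close>] have "ereal z = opt_value F" by simp
  with \<open>(y, z) \<in> F\<close> show ?thesis by blast
qed

section \<open>The program with the lower bound\<close>

lemma linear_program_PCLB:
  fixes I :: "'i set" and J :: "'j set"
  assumes "finite I" and "finite J"
  shows "linear_program J (PCLB_feasible I J p d LB)"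
proof -
  define H where "H a c b = {(y, z). (\<Sum>j\<in>J. a j * y j) + c * z \<ge> b}"
    for a :: "'j \<Rightarrow> real" and c b :: real
  have H: "linear_program J (H a c b)" for a c b
    unfolding H_def by (rule linear_program_halfspace)
  \<comment> \<open>The coefficients of \<open>y\<close> in the constraint of \<open>(i, j)\<close>, extended by zero to all of \<open>J\<close>.\<close>
  define w where "w i j j' = (if d i j' < d i j then d i j - max LB (d i j') else 0)" for i j j'
  have w: "(\<Sum>j'\<in>J. w i j j' * y j')
      = (\<Sum>j'\<in>{j'\<in>J. d i j' < d i j}. (d i j - max LB (d i j')) * y j')" for i j y
    unfolding w_def using \<open>finite J\<close>
    by (subst sum.inter_filter) (auto intro!: sum.cong)
  define T where "T = {(i, j)\<in>I \<times> J. d i j > LB}"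
  have "finite T" unfolding T_def
    by (rule finite_subset[of _ "I \<times> J"]) (use assms in auto)
  have unit: "(\<Sum>j'\<in>J. (if j' = j then s else 0) * y j') = s * y j"
    if "j \<in> J" for j s and y :: "'j \<Rightarrow> real"
    using \<open>finite J\<close> that by (subst sum.mono_neutral_right[of J "{j}"]) auto
  let ?total = "H (\<lambda>j. 1) 0 (real p) \<inter> H (\<lambda>j. - 1) 0 (- real p)"
  let ?cover = "\<Inter>(i, j)\<in>T. H (w i j) 1 (d i j)"
  let ?bound = "H (\<lambda>j. 0) 1 LB"
  let ?box = "\<Inter>j\<in>J. H (\<lambda>j'. if j' = j then 1 else 0) 0 0 \<inter>
      H (\<lambda>j'. if j' = j then - 1 else 0) 0 (- 1)"
  have "(y, z) \<in> PCLB_feasible I J p d LB \<longleftrightarrow> (y, z) \<in> ?total \<inter> ?cover \<inter> ?bound \<inter> ?box"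
    for y z
  proof -
    have "(y, z) \<in> ?total \<longleftrightarrow> (\<Sum>j\<in>J. y j) = real p"
      unfolding H_def by (auto simp: sum_negf)
    moreover have "(y, z) \<in> ?cover \<longleftrightarrow> (\<forall>i\<in>I. \<forall>j\<in>J. d i j > LB \<longrightarrow>
        z \<ge> d i j - (\<Sum>j'\<in>{j'\<in>J. d i j' < d i j}. (d i j - max LB (d i j')) * y j'))"
      unfolding H_def T_def by (auto simp: w diff_le_eq add.commute)
    moreover have "(y, z) \<in> ?bound \<longleftrightarrow> z \<ge> LB"
      unfolding H_def by simp
    moreover have "(y, z) \<in> ?box \<longleftrightarrow> (\<forall>j\<in>J. 0 \<le> y j \<and> y j \<le> 1)"
      unfolding H_def by (auto simp: unit)
    ultimately show ?thesis unfolding PCLB_feasible_def by simp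
  qed
  then have "PCLB_feasible I J p d LB = ?total \<inter> ?cover \<inter> ?bound \<inter> ?box" by auto
  moreover have "linear_program J (?total \<inter> ?cover \<inter> ?bound \<inter> ?box)"
    using \<open>finite T\<close> \<open>finite J\<close>
    by (intro linear_program_Int linear_program_INT) (auto simp: H)
  ultimately show ?thesis by simp
qed

text \<open>Opening every facility to the same fraction \<open>p / card J\<close> is feasible once \<open>z\<close> is large.\<close>

lemma PCLB_feasible_nonempty:
  assumes "finite I" and "finite J" and "J \<noteq> {}" and "p \<le> card J"
  shows "PCLB_feasible I J p d LB \<noteq> {}"
proof -
  define q where "q = real p / real (card J)"
  have "card J > 0" using assms by (simp add: card_gt_0_iff)
  then have q: "0 \<le> q" "q \<le> 1" "(\<Sum>j\<in>J. q) = real p"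
    using \<open>p \<le> card J\<close> by (auto simp: q_def)
  have "bdd_above ((\<lambda>(i, j). d i j) ` (I \<times> J))"
    using assms by (intro bdd_above_finite) auto
  then obtain M where M: "\<And>i j. i \<in> I \<Longrightarrow> j \<in> J \<Longrightarrow> d i j \<le> M"
    unfolding bdd_above_def by auto
  have "d i j - (\<Sum>j'\<in>{j'\<in>J. d i j' < d i j}. (d i j - max LB (d i j')) * q) \<le> max LB M"
    if "i \<in> I" "j \<in> J" "d i j > LB" for i j
  proof -
    have "0 \<le> (\<Sum>j'\<in>{j'\<in>J. d i j' < d i j}. (d i j - max LB (d i j')) * q)"
      using that q by (intro sum_nonneg mult_nonneg_nonneg) auto
    then show ?thesis using M[OF that(1,2)] by linarith
  qed
  then have "(\<lambda>_. q, max LB M) \<in> PCLB_feasible I J p d LB"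
    unfolding PCLB_feasible_def using q by auto
  then show ?thesis by blast
qed

text \<open>
  Every term subtracted in the strengthened constraint is nonnegative, so one open facility \<open>k\<close>
  with \<open>d i k < LB\<close>, whose term is \<open>d i j - LB\<close>, already makes the constraint a consequence of
  \<open>LB \<le> z\<close>. Without such a facility, \<open>max LB (d i j') = d i j'\<close> wherever \<open>y j' \<noteq> 0\<close>.
\<close>

lemma PC2_feasible_subset_PCLB_feasible:
  assumes "finite J" and "ereal LB \<le> opt_value (PC2_feasible I J p d)"
  shows "PC2_feasible I J p d \<subseteq> PCLB_feasible I J p d LB"
proof (rule subrelI)
  fix y z assume yz: "(y, z) \<in> PC2_feasible I J p d"
  have "ereal LB \<le> ereal z" using assms(2) opt_value_lower[OF yz] by (rule order_trans)
  then have "LB \<le> z" by simp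
  have binary: "y j = 0 \<or> y j = 1" if "j \<in> J" for j
    using yz that unfolding PC2_feasible_def by auto
  have "d i j - (\<Sum>j'\<in>{j'\<in>J. d i j' < d i j}. (d i j - max LB (d i j')) * y j') \<le> z"
    if "i \<in> I" "j \<in> J" "LB < d i j" for i j
  proof (cases "\<exists>k\<in>J. y k = 1 \<and> d i k < LB")
    case True
    then obtain k where k: "k \<in> J" "y k = 1" "d i k < LB" by blast
    have nonneg: "0 \<le> (d i j - max LB (d i j')) * y j'"
      if "j' \<in> {j'\<in>J. d i j' < d i j}" for j'
      using that \<open>LB < d i j\<close> binary[of j'] by auto
    have "(d i j - max LB (d i k)) * y k
        \<le> (\<Sum>j'\<in>{j'\<in>J. d i j' < d i j}. (d i j - max LB (d i j')) * y j')"
      using k \<open>LB < d i j\<close> \<open>finite J\<close> nonneg by (intro member_le_sum) auto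
    then show ?thesis using k \<open>LB \<le> z\<close> by simp
  next
    case False
    have "(\<Sum>j'\<in>{j'\<in>J. d i j' < d i j}. (d i j - max LB (d i j')) * y j')
        = (\<Sum>j'\<in>{j'\<in>J. d i j' < d i j}. (d i j - d i j') * y j')"
    proof (rule sum.cong)
      fix j' assume "j' \<in> {j'\<in>J. d i j' < d i j}"
      then show "(d i j - max LB (d i j')) * y j' = (d i j - d i j') * y j'"
        using False binary[of j'] by (auto simp: not_less max_absorb2)
    qed simp
    then show ?thesis using yz that(1,2) unfolding PC2_feasible_def by auto
  qed
  moreover have "0 \<le> y j \<and> y j \<le> 1" if "j \<in> J" for j using binary[OF that] by auto
  moreover have "(\<Sum>j\<in>J. y j) = real p" using yz unfolding PC2_feasible_def by simp
  ultimately show "(y, z) \<in> PCLB_feasible I J p d LB"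
    using \<open>LB \<le> z\<close> unfolding PCLB_feasible_def by simp
qed

theorem theorem6:
  fixes I :: "'i set" and J :: "'j set" and p :: nat
    and d :: "'i \<Rightarrow> 'j \<Rightarrow> real" and LB :: real
  assumes "finite I" and "I \<noteq> {}"
    and "finite J" and "J \<noteq> {}"
    and "1 \<le> p" and "p \<le> card J"
    and "\<And>i j. i \<in> I \<Longrightarrow> j \<in> J \<Longrightarrow> 0 \<le> d i j"
    and "0 \<le> LB"
    and "ereal LB \<le> opt_value (PC2_feasible I J p d)"
  shows "LP_relaxation_PC2 I J p d (PCLB_feasible I J p d LB) \<and>
    (\<exists>(y, z) \<in> PCLB_feasible I J p d LB. ereal z = opt_value (PCLB_feasible I J p d LB)) \<and>
    opt_value (PCLB_feasible I J p d LB) \<le> opt_value (PC2_feasible I J p d) \<and>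
    ereal LB \<le> opt_value (PCLB_feasible I J p d LB)"
proof (intro conjI)
  have lp: "linear_program J (PCLB_feasible I J p d LB)"
    using assms(1,3) by (rule linear_program_PCLB)
  have sub: "PC2_feasible I J p d \<subseteq> PCLB_feasible I J p d LB"
    using assms(3,9) by (rule PC2_feasible_subset_PCLB_feasible)
  show "LP_relaxation_PC2 I J p d (PCLB_feasible I J p d LB)"
    unfolding LP_relaxation_PC2_def using lp sub by simp
  show "\<exists>(y, z) \<in> PCLB_feasible I J p d LB. ereal z = opt_value (PCLB_feasible I J p d LB)"
    using lp PCLB_feasible_nonempty[OF assms(1,3,4,6)]
    by (rule linear_program_attains_opt_value[where l = LB]) (auto simp: PCLB_feasible_def)
  show "opt_value (PCLB_feasible I J p d LB) \<le> opt_value (PC2_feasible I J p d)"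
    using sub by (rule opt_value_mono)
  show "ereal LB \<le> opt_value (PCLB_feasible I J p d LB)"
    by (rule opt_value_greatest) (auto simp: PCLB_feasible_def)
qed

end
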